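(* Let $\alpha\in(0,1)$, $W_0\in[0,\alpha]$, and let $(\mathcal X_i)_{i\in\mathbb N}$ be monotone conflict sets. Let $(\gamma_i)_{i\in\mathbb N}$ be a non-negative sequence that sums up to $1$; for every $j\in\mathbb N$ let $(g^*_{j,i})_{i=j+1}^\infty$ and $(h^*_{j,i})_{i=j+1}^\infty$ be non-negative sequences such that $g^*_{j,i}=h^*_{j,i}=0$ if $j\in\mathcal X_i$, $\sum_{i>j,\,j\notin\mathcal X_i}g^*_{j,i}\le1$ and $\sum_{i>j,\,j\notin\mathcal X_i}h^*_{j,i}\le1$. Let $\gamma_i$, $g^*_{j,i}$, $\tau_i\in(0,1]$ and $\lambda_i\in[0,\tau_i)$ be $\mathcal G_{-\mathcal X_i}$-measurable. The $\text{FDR-ADDIS-Graph}_{\text{conf}}$ tests each hypothesis $H_i$ at level $\alpha_i=\min(\hat\alpha_i,\lambda_i)$ (rejecting $H_i$ iff $P_i\le\alpha_i$), where $$\hat\alpha_i=(\tau_i-\lambda_i)\left(W_0\gamma_i+\sum_{j=1}^{i-1}g^*_{j,i}(C_j-S_j+1)\frac{\hat\alpha_j}{\tau_j-\lambda_j}+\sum_{j=1}^{i-1}h^*_{j,i}R_j\left[\alpha K_j+(\alpha-W_0)(1-K_j)\right]\right),$$ with $S_j=\mathbf 1\{P_j\le\tau_j\}$, $C_j=\mathbf 1\{P_j\le\lambda_j\}$, $R_j=\mathbf 1\{P_j\le\alpha_j\}$, and $K_j=1$ if the first rejection happened within the first $j-1$ steps ($R_k=1$ for some $k\le j-1$), $K_j=0$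 otherwise. In the online testing setting described in the context, the following hold. (a) The $\text{FDR-ADDIS-Graph}_{\text{conf}}$ satisfies, for all $i\in\mathbb N$, $$\frac{\sum_{j=1}^{i}\frac{\alpha_j}{\tau_j-\lambda_j}(S_j-C_j)}{|R(i)|\vee1}\le\alpha .$$ (b) Thus, it controls the mFDR: $\mathrm{mFDR}(i)\le\alpha$ for all $i\in\mathbb N$. (c) Furthermore, it controls the FDR, i.e. $\mathrm{FDR}(i)\le\alpha$ for all $i\in\mathbb N$, when $\alpha_i$, $\lambda_i$ and $1-\tau_i$ are monotonic functions of the past and the null p-values are independent from each other and from the non-null p-values.
   Context: Online testing setting: $(H_i)_{i\in\mathbb N}$ is a sequence of null hypotheses with p-values $(P_i)_{i\in\mathbb N}$ in $[0,1]$. $I_0\subseteq\mathbb N$ is the index set of true null hypotheses. Each null p-value $P_i$, $i\in I_0$, is valid: $\mathbb P(P_i\le x)\le x$ for all $x\in[0,1]$. In case $\tau_i<1$, the null p-values $P_i$, $i\in I_0$, are moreover assumed uniformly valid: $\mathbb P(P_i\le xy\mid P_i\le y)\le x$ for all $x,y\in[0,1]$. As always in online testing, the individual significance levels depend only on previous p-values: $\alpha_i$ is measurable with respect to $\sigma(P_1,\dots,P_{i-1})$. Conflict sets: for each $i$, $\mathcal X_i\subseteq\{1,\dots,i-1\}$ is a (fixed) set containing all indices of previous p-values that are not stochastically independent of $P_i$, and possibly further indices (so $P_i$ is independent of the p-values $P_j$, $j<i$, $j\notin\mathcal X_i$); $\mathcal G_{-\mathcal X_i}=\sigma(\{P_j:j<i,\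 j\notin\mathcal X_i\})$. Monotone means: $j\in\mathcal X_i$ implies $j\in\mathcal X_k$ for all $k\in\{j+1,\dots,i-1\}$. $R(i)=\{j\le i:R_j=1\}$ is the index set of hypotheses rejected up to step $i$, $V(i)=I_0\cap R(i)$ that of falsely rejected ones, $a\vee b=\max(a,b)$, $$\mathrm{FDR}(i)=\mathbb E\left(\frac{|V(i)|}{|R(i)|\vee1}\right),\qquad \mathrm{mFDR}(i)=\frac{\mathbb E(|V(i)|)}{\mathbb E(|R(i)|\vee1)} .$$ $\alpha_i$, $\lambda_i$, $1-\tau_i$ ($i\in\mathbb N$) are monotonic functions of the past if they are coordinatewise nondecreasing functions in $(R_1,\dots,R_{i-1})$ and $(C_1,\dots,C_{i-1})$ and nonincreasing in $(S_1,\dots,S_{i-1})$.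
   Formalization: Part (b) fails as stated, since K_j may depend on p-values in the conflict set of i; it is proved under the added assumption that, for all j<i, h*_{j,i}R_j[αK_j+(α−W_0)(1−K_j)] is G_{-X_i}-measurable. *)

theory Defs
  imports "HOL-Probability.Probability"
begin

text \<open>
  Hypotheses are numbered from 0, so \<^term>\<open>{..<i}\<close> is the set of steps before step \<^term>\<open>i\<close>
  and \<^term>\<open>{..i}\<close> the set of steps up to and including step \<^term>\<open>i\<close>.
\<close>

definition pval_sigma :: "'a measure \<Rightarrow> (nat \<Rightarrow> 'a \<Rightarrow> real) \<Rightarrow> nat set \<Rightarrow> 'a measure" where
  "pval_sigma M P J = sigma (space M) (\<Union>j\<in>J. {P j -` A \<inter> space M | A. A \<in> sets borel})"

definition conflict_sets :: "'a measure \<Rightarrow> (nat \<Rightarrow> 'a \<Rightarrow> real) \<Rightarrow> (nat \<Rightarrow> nat set) \<Rightarrow> bool" where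
  "conflict_sets M P X \<longleftrightarrow>
     (\<forall>i. X i \<subseteq> {..<i} \<and>
          prob_space.indep_set M (sets (pval_sigma M P {i})) (sets (pval_sigma M P ({..<i} - X i))))"

definition monotone_conflict_sets :: "(nat \<Rightarrow> nat set) \<Rightarrow> bool" where
  "monotone_conflict_sets X \<longleftrightarrow> (\<forall>i. \<forall>j\<in>X i. \<forall>k. j < k \<and> k < i \<longrightarrow> j \<in> X k)"

definition valid_pval :: "'a measure \<Rightarrow> ('a \<Rightarrow> real) \<Rightarrow> bool" where
  "valid_pval M p \<longleftrightarrow> (\<forall>x\<in>{0..1}. \<P>(\<omega> in M. p \<omega> \<le> x) \<le> x)"

text \<open>Since \<^const>\<open>cond_prob\<close> is 0 when the conditioning event has probability 0, the
  condition is void for such \<open>y\<close>.\<close>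

definition uniformly_valid_pval :: "'a measure \<Rightarrow> ('a \<Rightarrow> real) \<Rightarrow> bool" where
  "uniformly_valid_pval M p \<longleftrightarrow>
     (\<forall>x\<in>{0..1}. \<forall>y\<in>{0..1}. \<P>(\<omega> in M. p \<omega> \<le> x * y \<bar> p \<omega> \<le> y) \<le> x)"

definition rejections :: "(nat \<Rightarrow> 'a \<Rightarrow> real) \<Rightarrow> nat \<Rightarrow> 'a \<Rightarrow> nat set" where
  "rejections R i \<omega> = {j. j \<le> i \<and> R j \<omega> = 1}"

definition FDR :: "'a measure \<Rightarrow> nat set \<Rightarrow> (nat \<Rightarrow> 'a \<Rightarrow> real) \<Rightarrow> nat \<Rightarrow> real" where
  "FDR M I0 R i =
     (\<integral>\<omega>. real (card (I0 \<inter> rejections R i \<omega>)) / real (max (card (rejections R i \<omega>)) 1) \<partial>M)"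

definition mFDR :: "'a measure \<Rightarrow> nat set \<Rightarrow> (nat \<Rightarrow> 'a \<Rightarrow> real) \<Rightarrow> nat \<Rightarrow> real" where
  "mFDR M I0 R i =
     (\<integral>\<omega>. real (card (I0 \<inter> rejections R i \<omega>)) \<partial>M) /
     (\<integral>\<omega>. real (max (card (rejections R i \<omega>)) 1) \<partial>M)"

text \<open>\<open>Y\<close> is a function \<open>f\<close> of the indicators at the steps before \<open>i\<close>, nondecreasing in \<open>R\<close> and \<open>C\<close>
  and nonincreasing in \<open>S\<close>. That \<open>f\<close> ignores later coordinates follows from the comparison
  being restricted to \<open>j < i\<close>.\<close>

definition monotonic_in_past ::
  "'a measure \<Rightarrow> (nat \<Rightarrow> 'a \<Rightarrow> real) \<Rightarrow> (nat \<Rightarrow> 'a \<Rightarrow> real) \<Rightarrow> (nat \<Rightarrow> 'a \<Rightarrow> real) \<Rightarrow>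
   nat \<Rightarrow> ('a \<Rightarrow> real) \<Rightarrow> bool" where
  "monotonic_in_past M R C S i Y \<longleftrightarrow>
     (\<exists>f :: (nat \<Rightarrow> real) \<Rightarrow> (nat \<Rightarrow> real) \<Rightarrow> (nat \<Rightarrow> real) \<Rightarrow> real.
        (\<forall>r r' c c' s s'.
           range r \<union> range r' \<union> range c \<union> range c' \<union> range s \<union> range s' \<subseteq> {0, 1} \<and>
           (\<forall>j<i. r j \<le> r' j \<and> c j \<le> c' j \<and> s' j \<le> s j) \<longrightarrow>
           f r c s \<le> f r' c' s') \<and>
        (\<forall>\<omega>\<in>space M. Y \<omega> = f (\<lambda>j. R j \<omega>) (\<lambda>j. C j \<omega>) (\<lambda>j. S j \<omega>)))"

end

theory Submission
  imports Defs
begin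

text \<open>
  The levels are paid from a budget. In (a), every unit of weight is passed on at most once: the
  initial wealth along \<open>\<gamma>\<close>, the weight of steps with \<open>S j - C j = 0\<close> along \<open>g\<close>, and a reward of at most
  \<open>\<alpha>\<close> per rejection along \<open>h\<close>. The link with false rejections is that a null p-value \<open>p\<close> satisfies
  \<open>\<P>(p \<le> a) \<le> a / (\<tau> - \<lambda>) * \<P>(\<lambda> < p \<le> \<tau>)\<close>, conditionally on any independent \<open>\<sigma>\<close>-algebra with respect
  to which the three levels are measurable. For the mFDR this is the non-conflicting past; for the
  FDR it is the one generated by all other p-values, with the inverse of the number of rejections as
  a weight.
\<close>

section \<open>The deterministic budget of the graph\<close>

text \<open>The first rejection pays only \<open>\<alpha> - W0\<close>, which tops the initial
  wealth up to \<open>\<alpha>\<close>, and each later one pays \<open>\<alpha>\<close>; hence the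
  two cases.\<close>

lemma addis_rewards_bound:
  fixes \<alpha> W0 :: real and B :: "nat set"
  shows "W0 + (\<Sum>j<n. of_bool (j \<in> B) *
            (\<alpha> * of_bool (\<exists>k<j. k \<in> B) + (\<alpha> - W0) * (1 - of_bool (\<exists>k<j. k \<in> B))))
         = (if card {j\<in>B. j < n} = 0 then W0 else \<alpha> * card {j\<in>B. j < n})"
proof (induction n)
  case (Suc n)
  have *: "{j\<in>B. j < Suc n} = (if n \<in> B then insert n {j\<in>B. j < n} else {j\<in>B. j < n})"
    by (auto simp: less_Suc_eq)
  have "(card {j\<in>B. j < n} = 0) \<longleftrightarrow> \<not> (\<exists>k<n. k \<in> B)"
    by auto
  with Suc show ?case
    unfolding * by (auto simp: algebra_simps)
qed simp

text \<open>Everything refers to one fixed outcome: \<open>w\<close> stands for \<open>ahat\<close>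
  divided by \<tau> - \<lambda>, and \<open>u\<close> for 1 - (S - C). When the recursion is summed
  over all steps and the sums are exchanged, step \<open>j\<close> hands on at most
  \<open>u j * w j\<close> through \<open>g\<close> and at most \<open>rew j\<close> through
  \<open>h\<close>. The first amount cancels against the left side; what remains is the initial
  wealth plus all rewards.\<close>

lemma addis_graph:
  fixes \<alpha> W0 :: real and w u \<gamma> :: "nat \<Rightarrow> real" and g h :: "nat \<Rightarrow> nat \<Rightarrow> real" and B :: "nat set"
  defines "rew \<equiv> \<lambda>j. of_bool (j \<in> B) *
            (\<alpha> * of_bool (\<exists>k<j. k \<in> B) + (\<alpha> - W0) * (1 - of_bool (\<exists>k<j. k \<in> B)))"
  assumes W0: "0 \<le> W0" "W0 \<le> \<alpha>"
    and \<gamma>: "\<And>i. 0 \<le> \<gamma> i" "(\<Sum>j\<le>i. \<gamma> j) \<le> 1"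
    and g: "\<And>j i. j < i \<Longrightarrow> 0 \<le> g j i" "\<And>j i. (\<Sum>k\<in>{j<..i}. g j k) \<le> 1"
    and h: "\<And>j i. j < i \<Longrightarrow> 0 \<le> h j i" "\<And>j i. (\<Sum>k\<in>{j<..i}. h j k) \<le> 1"
    and u: "\<And>i. u i \<in> {0, 1}"
    and w: "\<And>i. w i = W0 * \<gamma> i + (\<Sum>j<i. g j i * u j * w j) + (\<Sum>j<i. h j i * rew j)"
  shows addis_graph_nonneg: "0 \<le> w i"
    and addis_graph_budget: "(\<Sum>j\<le>i. w j * (1 - u j)) \<le> \<alpha> * real (max (card {j\<in>B. j \<le> i}) 1)"
proof -
  have rew: "0 \<le> rew j" for j
    using W0 by (auto simp: rew_def)
  have u0: "0 \<le> u j" for j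
    using u[of j] by auto
  show w0: "0 \<le> w i" for i
  proof (induction i rule: less_induct)
    case (less i)
    have "0 \<le> (\<Sum>j<i. g j i * u j * w j)" "0 \<le> (\<Sum>j<i. h j i * rew j)"
      using less g h u0 rew by (auto intro!: sum_nonneg mult_nonneg_nonneg)
    then show ?case
      using W0 \<gamma>(1)[of i] by (subst w) simp
  qed
  have swap: "(\<Sum>m\<le>i. \<Sum>j<m. c j m * f j) \<le> (\<Sum>j\<le>i. f j)"
    if "\<And>j. 0 \<le> f j" "\<And>j. (\<Sum>m\<in>{j<..i}. c j m) \<le> 1" for c :: "nat \<Rightarrow> nat \<Rightarrow> real" and f
  proof -
    have "(\<Sum>m\<le>i. \<Sum>j<m. c j m * f j) = (\<Sum>m\<le>i. \<Sum>j\<in>{j. j \<in> {..i} \<and> j < m}. c j m * f j)"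
      by (intro sum.cong) auto
    also have "\<dots> = (\<Sum>j\<le>i. \<Sum>m\<in>{m. m \<in> {..i} \<and> j < m}. c j m * f j)"
      by (rule sum.swap_restrict) auto
    also have "\<dots> = (\<Sum>j\<le>i. (\<Sum>m\<in>{j<..i}. c j m) * f j)"
      unfolding sum_distrib_right by (intro sum.cong) auto
    also have "\<dots> \<le> (\<Sum>j\<le>i. 1 * f j)"
      using that by (intro sum_mono mult_right_mono) auto
    finally show ?thesis by simp
  qed
  have "(\<Sum>j\<le>i. w j) = W0 * (\<Sum>j\<le>i. \<gamma> j) + (\<Sum>m\<le>i. \<Sum>j<m. g j m * (u j * w j))
      + (\<Sum>m\<le>i. \<Sum>j<m. h j m * rew j)"
    by (subst w) (simp add: sum.distrib sum_distrib_left mult.assoc)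
  also have "\<dots> \<le> W0 * 1 + (\<Sum>j\<le>i. u j * w j) + (\<Sum>j\<le>i. rew j)"
    using W0 \<gamma> g h u0 w0 rew by (intro add_mono mult_left_mono swap) auto
  finally have "(\<Sum>j\<le>i. w j * (1 - u j)) \<le> W0 + (\<Sum>j<Suc i. rew j)"
    by (simp add: algebra_simps sum_subtractf lessThan_Suc_atMost)
  \<comment> \<open>The rewards run up to and including step \<open>i\<close>, so a rejection at
    \<open>i\<close> counts at once. With a rejection their total is exactly the bound; without one,
    \<open>W0 \<le> \<alpha>\<close> is absorbed by the \<open>max\<close> with 1.\<close>
  also have "\<dots> \<le> \<alpha> * real (max (card {j\<in>B. j \<le> i}) 1)"
  proof (cases "card {j\<in>B. j \<le> i} = 0")
    case False
    then have "max (card {j\<in>B. j \<le> i}) 1 = card {j\<in>B. j \<le> i}" by linarith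
    with False show ?thesis
      unfolding rew_def addis_rewards_bound less_Suc_eq_le by (simp only: if_False order_refl)
  next
    case True
    with W0 show ?thesis
      unfolding rew_def addis_rewards_bound less_Suc_eq_le by simp
  qed
  finally show "(\<Sum>j\<le>i. w j * (1 - u j)) \<le> \<alpha> * real (max (card {j\<in>B. j \<le> i}) 1)" .
qed

section \<open>Rejection probability of a single null p-value at fixed levels\<close>

text \<open>With \<open>F\<close> the distribution function of \<open>p\<close>, validity gives
  \<open>F y \<le> y / t * F t\<close> for y \<le> t. At \<open>x\<close> this bounds the left side;
  at \<open>l\<close> it shows that the interval from \<open>l\<close> to \<open>t\<close> has
  probability at least (1 - l / t) F(t). The quotient of x / t and 1 - l / t is x / (t - l).\<close>

lemma (in prob_space) null_interval_bound:
  assumes p: "p \<in> borel_measurable M" "\<And>\<omega>. \<omega> \<in> space M \<Longrightarrow> p \<omega> \<le> 1"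
    and valid: "valid_pval M p" "t = 1 \<or> uniformly_valid_pval M p"
    and x: "0 \<le> x" "x \<le> l" "l < t" "t \<le> 1"
  shows "\<P>(\<omega> in M. p \<omega> \<le> x) \<le> x / (t - l) * \<P>(\<omega> in M. l < p \<omega> \<and> p \<omega> \<le> t)"
proof -
  note [measurable] = p(1)
  define F where "F y = \<P>(\<omega> in M. p \<omega> \<le> y)" for y
  have F0: "0 \<le> F y" for y
    by (simp add: F_def)
  have scale: "F y \<le> y / t * F t" if "0 \<le> y" "y \<le> t" for y
  proof (cases "t = 1")
    \<comment> \<open>Since p \<le> 1, the distribution function is 1 at \<open>t\<close>, and plain
      validity suffices.\<close>
    case True
    then have "F t = 1"
      using p(2) by (simp add: F_def prob_space cong: conj_cong)
    moreover have "F y \<le> y"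
      using valid(1) that True by (simp add: valid_pval_def F_def)
    ultimately show ?thesis
      using True by simp
  next
    case False
    then have "\<P>(\<omega> in M. p \<omega> \<le> y / t * t \<bar> p \<omega> \<le> t) \<le> y / t"
      using valid(2) that x False unfolding uniformly_valid_pval_def
      by (auto intro!: bspec[where x = t] bspec[where x = "y / t"] simp del: times_divide_eq_left)
    moreover have "{\<omega> \<in> space M. p \<omega> \<le> y / t * t \<and> p \<omega> \<le> t} = {\<omega> \<in> space M. p \<omega> \<le> y}"
      using that x by auto
    ultimately have *: "F y / F t \<le> y / t"
      by (simp add: cond_prob_def F_def)
    \<comment> \<open>If \<open>F t = 0\<close>, the conditional probability is 0 by convention and
      carries no information; monotonicity then forces \<open>F y = 0\<close>.\<close>
    have "F y \<le> F t"
      using that unfolding F_def by (intro finite_measure_mono) auto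
    then show ?thesis
      using * F0[of t] F0[of y] by (cases "F t = 0") (auto simp: divide_le_eq)
  qed
  have "{\<omega> \<in> space M. l < p \<omega> \<and> p \<omega> \<le> t} = {\<omega> \<in> space M. p \<omega> \<le> t} - {\<omega> \<in> space M. p \<omega> \<le> l}"
    by auto
  moreover have "prob ({\<omega> \<in> space M. p \<omega> \<le> t} - {\<omega> \<in> space M. p \<omega> \<le> l}) = F t - F l"
    using x unfolding F_def by (intro finite_measure_Diff) auto
  ultimately have diff: "\<P>(\<omega> in M. l < p \<omega> \<and> p \<omega> \<le> t) = F t - F l"
    by simp
  have "F x \<le> x / t * F t"
    using scale x by simp
  also have "\<dots> = x / (t - l) * (F t - l / t * F t)"
    using x by (simp add: field_simps)
  also have "\<dots> \<le> x / (t - l) * (F t - F l)"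
    using scale[of l] x by (intro mult_left_mono) auto
  finally show ?thesis
    by (simp add: F_def[symmetric] diff)
qed

section \<open>The \<sigma>-algebras generated by sets of p-values\<close>

lemma sets_pval_sigma:
  "sets (pval_sigma M P J) = sigma_sets (space M) (\<Union>j\<in>J. {P j -` A \<inter> space M | A. A \<in> sets borel})"
  unfolding pval_sigma_def by (rule sets_measure_of) auto

lemma space_pval_sigma [simp]: "space (pval_sigma M P J) = space M"
  unfolding pval_sigma_def by (rule space_measure_of) auto

lemma subalgebra_pval_sigma:
  assumes "\<And>i. i \<in> J \<Longrightarrow> P i \<in> borel_measurable M"
  shows "subalgebra M (pval_sigma M P J)"
  using assms unfolding subalgebra_def sets_pval_sigma
  by (auto intro!: sets.sigma_sets_subset measurable_sets)

lemma measurable_pval_sigma: "j \<in> J \<Longrightarrow> P j \<in> borel_measurable (pval_sigma M P J)"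
  by (rule measurableI) (auto simp: sets_pval_sigma intro!: sigma_sets.Basic)

lemma pval_sigma_mono:
  assumes "f \<in> measurable (pval_sigma M P J) N" "J \<subseteq> J'"
  shows "f \<in> measurable (pval_sigma M P J') N"
proof (rule measurable_from_subalg[OF _ assms(1)])
  show "subalgebra (pval_sigma M P J') (pval_sigma M P J)"
    using assms(2) unfolding subalgebra_def sets_pval_sigma by (intro conjI sigma_sets_mono') auto
qed

section \<open>Integrating out an independent p-value\<close>

text \<open>By independence the law of \<open>(\<omega>, p \<omega>)\<close> on
  \<open>G \<Otimes>\<^sub>M borel\<close> is the product of \<open>M\<close> restricted to
  \<open>G\<close> and the law of \<open>p\<close>; Tonelli's theorem then integrates out
  \<open>p\<close> with the first component frozen.\<close>

lemma (in prob_space) nn_integral_indep_subalgebra: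
  assumes p: "p \<in> borel_measurable M" and G: "subalgebra M G"
    and indep: "indep_set (sigma_sets (space M) {p -` A \<inter> space M | A. A \<in> sets borel}) (sets G)"
    and f: "f \<in> borel_measurable (G \<Otimes>\<^sub>M borel)"
  shows "(\<integral>\<^sup>+\<omega>. f (\<omega>, p \<omega>) \<partial>M) = (\<integral>\<^sup>+\<omega>. (\<integral>\<^sup>+\<omega>'. f (\<omega>, p \<omega>') \<partial>M) \<partial>M)"
proof -
  \<comment> \<open>The identity is read as a random variable with values in the coarser space
    \<open>G\<close>; its distribution is the restriction of \<open>M\<close> to
    \<open>G\<close>.\<close>
  have id: "(\<lambda>x. x) \<in> measurable M G"
    using G by (auto simp: subalgebra_def intro!: measurableI)
  interpret D: prob_space "distr M borel p"
    by (rule prob_space_distr) fact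
  interpret I: prob_space "distr M G (\<lambda>x. x)"
    by (rule prob_space_distr) fact
  have pair: "(\<lambda>x. (x, p x)) \<in> measurable M (G \<Otimes>\<^sub>M borel)"
    using id p by measurable
  have distr: "distr M G (\<lambda>x. x) \<Otimes>\<^sub>M distr M borel p = distr M (G \<Otimes>\<^sub>M borel) (\<lambda>x. (x, p x))"
  proof (rule pair_measure_eqI)
    fix A B assume "A \<in> sets (distr M G (\<lambda>x. x))" "B \<in> sets (distr M borel p)"
    then have A: "A \<in> sets G" and B: "B \<in> sets borel" by auto
    have "A \<subseteq> space M"
      using G A sets.sets_into_space[of A G] by (auto simp: subalgebra_def)
    then have "(\<lambda>x. x) -` A \<inter> space M = A" "(\<lambda>x. (x, p x)) -` (A \<times> B) \<inter> space M = (p -` B \<inter> space M) \<inter> A"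
      by auto
    moreover have "prob ((p -` B \<inter> space M) \<inter> A) = prob (p -` B \<inter> space M) * prob A"
      using A B by (intro indep_setD[OF indep]) (auto intro: sigma_sets.Basic)
    ultimately show "emeasure (distr M G (\<lambda>x. x)) A * emeasure (distr M borel p) B =
        emeasure (distr M (G \<Otimes>\<^sub>M borel) (\<lambda>x. (x, p x))) (A \<times> B)"
      using id p pair A B
      by (simp add: emeasure_distr emeasure_eq_measure ennreal_mult mult.commute)
  qed (auto intro: D.sigma_finite_measure_axioms I.sigma_finite_measure_axioms cong: sets_pair_measure_cong)
  have f': "f \<in> borel_measurable (distr M G (\<lambda>x. x) \<Otimes>\<^sub>M distr M borel p)"
    using f by (simp cong: measurable_cong_sets)
  have "(\<integral>\<^sup>+\<omega>. f (\<omega>, p \<omega>) \<partial>M) = integral\<^sup>N (distr M (G \<Otimes>\<^sub>M borel) (\<lambda>x. (x, p x))) f"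
    using f id p by (subst nn_integral_distr) auto
  also have "\<dots> = (\<integral>\<^sup>+\<omega>. (\<integral>\<^sup>+y. f (\<omega>, y) \<partial>distr M borel p) \<partial>distr M G (\<lambda>x. x))"
    unfolding distr[symmetric] by (rule D.nn_integral_fst[symmetric]) fact
  also have "\<dots> = (\<integral>\<^sup>+\<omega>. (\<integral>\<^sup>+y. f (\<omega>, y) \<partial>distr M borel p) \<partial>M)"
    using f id p D.borel_measurable_nn_integral_fst[of f G]
    by (subst nn_integral_distr) (auto cong: measurable_cong_sets)
  also have "\<dots> = (\<integral>\<^sup>+\<omega>. (\<integral>\<^sup>+\<omega>'. f (\<omega>, p \<omega>') \<partial>M) \<partial>M)"
    using f p G by (intro nn_integral_cong nn_integral_distr) (auto simp: subalgebra_def)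
  finally show ?thesis .
qed

lemma (in prob_space) null_rejection_bound:
  fixes a l t v :: "'a \<Rightarrow> real"
  assumes p: "p \<in> borel_measurable M" "\<And>\<omega>. \<omega> \<in> space M \<Longrightarrow> p \<omega> \<le> 1"
    and valid: "valid_pval M p" "(\<exists>\<omega>\<in>space M. t \<omega> < 1) \<Longrightarrow> uniformly_valid_pval M p"
    and G: "subalgebra M G"
    and indep: "indep_set (sigma_sets (space M) {p -` A \<inter> space M | A. A \<in> sets borel}) (sets G)"
    and meas: "a \<in> borel_measurable G" "l \<in> borel_measurable G" "t \<in> borel_measurable G"
      "v \<in> borel_measurable G"
    and levels: "\<And>\<omega>. \<omega> \<in> space M \<Longrightarrow> 0 \<le> a \<omega> \<and> a \<omega> \<le> l \<omega> \<and> l \<omega> < t \<omega> \<and> t \<omega> \<le> 1 \<and> 0 \<le> v \<omega>"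
    and int: "integrable M (\<lambda>\<omega>. of_bool (p \<omega> \<le> a \<omega>) * v \<omega>)"
      "integrable M (\<lambda>\<omega>. a \<omega> / (t \<omega> - l \<omega>) * of_bool (l \<omega> < p \<omega> \<and> p \<omega> \<le> t \<omega>) * v \<omega>)"
  shows "(\<integral>\<omega>. of_bool (p \<omega> \<le> a \<omega>) * v \<omega> \<partial>M) \<le>
    (\<integral>\<omega>. a \<omega> / (t \<omega> - l \<omega>) * of_bool (l \<omega> < p \<omega> \<and> p \<omega> \<le> t \<omega>) * v \<omega> \<partial>M)"
proof -
  note [measurable] = p(1) meas
  define f1 :: "'a \<times> real \<Rightarrow> real" where "f1 = (\<lambda>(\<omega>, y). of_bool (y \<le> a \<omega>) * v \<omega>)"
  define f2 where
    "f2 = (\<lambda>(\<omega>, y). a \<omega> / (t \<omega> - l \<omega>) * of_bool (l \<omega> < y \<and> y \<le> t \<omega>) * v \<omega>)"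
  have [measurable]: "f1 \<in> borel_measurable (G \<Otimes>\<^sub>M borel)" "f2 \<in> borel_measurable (G \<Otimes>\<^sub>M borel)"
    unfolding f1_def f2_def by measurable
  have "(\<integral>\<^sup>+\<omega>. ennreal (f1 (\<omega>, p \<omega>)) \<partial>M) = (\<integral>\<^sup>+\<omega>. (\<integral>\<^sup>+\<omega>'. ennreal (f1 (\<omega>, p \<omega>')) \<partial>M) \<partial>M)"
    by (rule nn_integral_indep_subalgebra[OF p(1) G indep]) measurable
  also have "\<dots> \<le> (\<integral>\<^sup>+\<omega>. (\<integral>\<^sup>+\<omega>'. ennreal (f2 (\<omega>, p \<omega>')) \<partial>M) \<partial>M)"
  proof (rule nn_integral_mono)
    fix \<omega> assume \<omega>: "\<omega> \<in> space M"
    have "(\<integral>\<^sup>+\<omega>'. ennreal (f1 (\<omega>, p \<omega>')) \<partial>M) =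
        (\<integral>\<^sup>+\<omega>'. ennreal (v \<omega>) * indicator {\<omega>'\<in>space M. p \<omega>' \<le> a \<omega>} \<omega>' \<partial>M)"
      by (intro nn_integral_cong) (auto simp: f1_def indicator_def)
    also have "\<dots> = ennreal (v \<omega> * \<P>(\<omega>' in M. p \<omega>' \<le> a \<omega>))"
      using levels[OF \<omega>] by (subst nn_integral_cmult_indicator) (auto simp: emeasure_eq_measure ennreal_mult)
    also have "\<dots> \<le> ennreal (v \<omega> * (a \<omega> / (t \<omega> - l \<omega>) * \<P>(\<omega>' in M. l \<omega> < p \<omega>' \<and> p \<omega>' \<le> t \<omega>)))"
    proof (intro ennreal_leI mult_left_mono null_interval_bound p valid(1))
      show "t \<omega> = 1 \<or> uniformly_valid_pval M p"
        using valid(2) levels \<omega> by force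
    qed (use levels \<omega> in auto)
    also have "\<dots> = (\<integral>\<^sup>+\<omega>'. ennreal (v \<omega> * (a \<omega> / (t \<omega> - l \<omega>))) *
        indicator {\<omega>'\<in>space M. l \<omega> < p \<omega>' \<and> p \<omega>' \<le> t \<omega>} \<omega>' \<partial>M)"
      using levels[OF \<omega>]
      by (subst nn_integral_cmult_indicator)
         (auto simp: emeasure_eq_measure ennreal_mult[symmetric] mult.assoc)
    also have "\<dots> = (\<integral>\<^sup>+\<omega>'. ennreal (f2 (\<omega>, p \<omega>')) \<partial>M)"
      by (intro nn_integral_cong) (auto simp: f2_def indicator_def mult.commute)
    finally show "(\<integral>\<^sup>+\<omega>'. ennreal (f1 (\<omega>, p \<omega>')) \<partial>M) \<le> (\<integral>\<^sup>+\<omega>'. ennreal (f2 (\<omega>, p \<omega>')) \<partial>M)" .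
  qed
  also have "\<dots> = (\<integral>\<^sup>+\<omega>. ennreal (f2 (\<omega>, p \<omega>)) \<partial>M)"
    by (rule nn_integral_indep_subalgebra[OF p(1) G indep, symmetric]) measurable
  finally have le: "(\<integral>\<^sup>+\<omega>. ennreal (f1 (\<omega>, p \<omega>)) \<partial>M) \<le> (\<integral>\<^sup>+\<omega>. ennreal (f2 (\<omega>, p \<omega>)) \<partial>M)" .
  \<comment> \<open>Non-negativity and integrability turn the inequality of extended integrals into
    one of real integrals.\<close>
  have "AE \<omega> in M. 0 \<le> f1 (\<omega>, p \<omega>)" "AE \<omega> in M. 0 \<le> f2 (\<omega>, p \<omega>)"
    using levels by (auto simp: f1_def f2_def intro!: AE_I2 mult_nonneg_nonneg divide_nonneg_nonneg less_imp_le)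
  with le int have "ennreal (\<integral>\<omega>. f1 (\<omega>, p \<omega>) \<partial>M) \<le> ennreal (\<integral>\<omega>. f2 (\<omega>, p \<omega>) \<partial>M)"
    "0 \<le> (\<integral>\<omega>. f2 (\<omega>, p \<omega>) \<partial>M)"
    by (auto simp: f1_def f2_def nn_integral_eq_integral[symmetric] intro!: integral_nonneg_AE)
  then show ?thesis
    by (simp add: f1_def f2_def ennreal_le_iff)
qed

section \<open>Independence of one null p-value from all the others\<close>

text \<open>The sets \<open>b \<inter> c\<close>, with \<open>b\<close> from the other nulls and
  \<open>c\<close> from the non-nulls, are closed under intersection and generate the
  \<sigma>-algebra of all p-values but the \<open>j\<close>-th. On them independence is checked
  directly, and it extends to the generated \<sigma>-algebra.\<close>

lemma (in prob_space) indep_nulls_imp_indep_rest: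
  assumes P: "\<And>i. P i \<in> borel_measurable M" and nulls: "indep_vars (\<lambda>_. borel) P I0"
    and rest: "indep_set (sets (pval_sigma M P I0)) (sets (pval_sigma M P (- I0)))"
    and j: "j \<in> I0"
  shows "indep_set (sets (pval_sigma M P {j})) (sets (pval_sigma M P (- {j})))"
proof -
  let ?E = "\<lambda>i. {P i -` A \<inter> space M | A. A \<in> sets borel}"
  let ?B = "sets (pval_sigma M P (I0 - {j}))" and ?C = "sets (pval_sigma M P (- I0))"
  have sub: "sets (pval_sigma M P J) \<subseteq> events" for J
    using subalgebra_pval_sigma[of J P M] P by (auto simp: subalgebra_def)
  have mono: "sets (pval_sigma M P J) \<subseteq> sets (pval_sigma M P J')" if "J \<subseteq> J'" for J J'
    using that unfolding sets_pval_sigma by (intro sigma_sets_mono') auto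
  have Int_stable_E: "Int_stable (?E i)" for i
  proof (rule Int_stableI)
    fix a b assume "a \<in> ?E i" "b \<in> ?E i"
    then obtain A B where "a = P i -` A \<inter> space M" "b = P i -` B \<inter> space M"
      "A \<in> sets borel" "B \<in> sets borel" by auto
    then show "a \<inter> b \<in> ?E i"
      by (intro CollectI exI[of _ "A \<inter> B"]) auto
  qed
  \<comment> \<open>The null indices are grouped into the disjoint blocks \<open>{j}\<close> and
    \<open>I0 - {j}\<close>, indexed by the booleans.\<close>
  have "indep_sets (\<lambda>b. sigma_sets (space M) (\<Union>i\<in>case_bool {j} (I0 - {j}) b. ?E i)) UNIV"
  proof (rule indep_sets_collect_sigma)
    show "indep_sets ?E (\<Union>b\<in>UNIV. case_bool {j} (I0 - {j}) b)"
      using nulls j unfolding indep_vars_def2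
      by (auto simp: UNIV_bool insert_absorb elim!: indep_sets_mono_index[rotated])
    show "disjoint_family_on (case_bool {j} (I0 - {j})) UNIV"
      by (auto simp: disjoint_family_on_def split: bool.splits)
  qed (rule Int_stable_E)
  then have null: "indep_set (sets (pval_sigma M P {j})) ?B"
    unfolding indep_set_def sets_pval_sigma
    by (rule indep_sets_mono_sets) (auto split: bool.splits)
  define D where "D = {b \<inter> c | b c. b \<in> ?B \<and> c \<in> ?C}"
  have "indep_set (sets (pval_sigma M P {j})) D"
    unfolding indep_sets2_eq
  proof (intro conjI ballI)
    show "D \<subseteq> events"
      using sub by (auto simp: D_def)
    fix a d assume a: "a \<in> sets (pval_sigma M P {j})" and "d \<in> D"
    then obtain b c where d: "d = b \<inter> c" and b: "b \<in> ?B" and c: "c \<in> ?C"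
      by (auto simp: D_def)
    \<comment> \<open>Both \<open>a\<close> and \<open>b\<close> are events of null p-values, so
      \<open>rest\<close> splits \<open>c\<close> off from \<open>a \<inter> b\<close> as a whole;
      \<open>null\<close> then separates \<open>a\<close> from \<open>b\<close>.\<close>
    have "a \<in> sets (pval_sigma M P I0)" "b \<in> sets (pval_sigma M P I0)"
      using mono[of "{j}" I0] mono[of "I0 - {j}" I0] a b j by auto
    then have "prob (a \<inter> b \<inter> c) = prob (a \<inter> b) * prob c" "prob (b \<inter> c) = prob b * prob c"
      using c by (auto intro!: indep_setD[OF rest])
    then show "prob (a \<inter> d) = prob a * prob d"
      using indep_setD[OF null a b] by (simp add: d Int_assoc)
  qed (rule sub)
  moreover have "Int_stable D"
  proof (rule Int_stableI)
    fix x y assume "x \<in> D" "y \<in> D"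
    then obtain b c b' c' where "x = b \<inter> c" "y = b' \<inter> c'" "b \<in> ?B" "c \<in> ?C" "b' \<in> ?B" "c' \<in> ?C"
      by (auto simp: D_def)
    then show "x \<inter> y \<in> D"
      unfolding D_def by (intro CollectI exI[of _ "b \<inter> b'"] exI[of _ "c \<inter> c'"]) auto
  qed
  ultimately have "indep_set (sigma_sets (space M) (sets (pval_sigma M P {j}))) (sigma_sets (space M) D)"
    by (intro indep_set_sigma_sets) (auto intro: Int_stableI)
  then have indep: "indep_set (sets (pval_sigma M P {j})) (sigma_sets (space M) D)"
    using sets.sigma_sets_eq[of "pval_sigma M P {j}"] by simp
  have "sets (pval_sigma M P (- {j})) \<subseteq> sigma_sets (space M) D"
    unfolding sets_pval_sigma
  proof (rule sigma_sets_mono, rule subsetI)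
    fix E assume "E \<in> (\<Union>i\<in>- {j}. ?E i)"
    then obtain i A where i: "i \<noteq> j" and A: "A \<in> sets (borel :: real measure)"
      and E: "E = P i -` A \<inter> space M"
      by auto
    have top: "space M \<in> sets (pval_sigma M P J)" for J
      using sets.top[of "pval_sigma M P J"] by simp
    have in_sigma: "P i -` A \<inter> space M \<in> sets (pval_sigma M P J)" if "i \<in> J" for J
      using measurable_sets[OF measurable_pval_sigma[OF that, of P M] A] by simp
    \<comment> \<open>A single generator lies in \<open>D\<close> with \<open>space M\<close> as the
      other factor.\<close>
    have "P i -` A \<inter> space M \<in> D"
    proof (cases "i \<in> I0")
      case True
      then show ?thesis
        unfolding D_def using i in_sigma top
        by (intro CollectI exI[of _ "P i -` A \<inter> space M"] exI[of _ "space M"]) auto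
    next
      case False
      then show ?thesis
        unfolding D_def using in_sigma top
        by (intro CollectI exI[of _ "P i -` A \<inter> space M"] exI[of _ "space M"]) auto
    qed
    then show "E \<in> sigma_sets (space M) D"
      unfolding E ..
  qed
  then show ?thesis
    using indep unfolding indep_sets2_eq by blast
qed

section \<open>Histories of observations and monotone dependence on them\<close>

text \<open>An observation records whether \<open>P\<close> is at most \<open>\<alpha>\<close>, \<open>\<lambda>\<close> and \<open>\<tau>\<close>, in this order; larger
  observations lead to larger values of the monotonic functions of the past.\<close>

type_synonym observation = "bool \<times> bool \<times> bool"

definition obs_le :: "observation \<Rightarrow> observation \<Rightarrow> bool" where
  "obs_le = (\<lambda>(r, c, s) (r', c', s'). (r \<longrightarrow> r') \<and> (c \<longrightarrow> c') \<and> (s' \<longrightarrow> s))"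

text \<open>Replays a run: the rule \<open>f\<close> sees the step number and the list of earlier
  observations. With the rule as an argument, it can be overridden at one step and two runs can be
  compared.\<close>

primrec history :: "(nat \<Rightarrow> observation list \<Rightarrow> observation) \<Rightarrow> nat \<Rightarrow> observation list" where
  "history f 0 = []"
| "history f (Suc k) = history f k @ [f k (history f k)]"

lemma length_history [simp]: "length (history f k) = k"
  by (induction k) auto

lemma history_eq:
  assumes "\<And>k. x k = f k (map x [0..<k])"
  shows "history f n = map x [0..<n]"
  using assms by (induction n) auto

text \<open>Ordered pasts give ordered next observations. Two rules are allowed so that a change
  forced at one step can be followed through all later steps.\<close>

lemma history_mono:
  assumes "\<And>k xs ys. length xs = k \<Longrightarrow> list_all2 obs_le xs ys \<Longrightarrow> obs_le (f k xs) (f' k ys)"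
  shows "list_all2 obs_le (history f n) (history f' n)"
  by (induction n) (auto intro!: list_all2_appendI assms)

text \<open>Lists of observations form a countable type, so measurability of the rule for each fixed
  past carries over to the random past.\<close>

lemma measurable_history:
  assumes "\<And>k xs. (\<lambda>\<omega>. f \<omega> k xs) \<in> measurable G (count_space UNIV)"
  shows "(\<lambda>\<omega>. history (f \<omega>) n) \<in> measurable G (count_space UNIV)"
proof (induction n)
  case (Suc n)
  have "(\<lambda>\<omega>. xs @ [f \<omega> n xs]) \<in> measurable G (count_space UNIV)" for xs
    using measurable_compose[OF assms[of n xs], of "\<lambda>x. xs @ [x]"] by simp
  from measurable_compose_countable[OF this Suc] show ?case
    by simp
qed simp

lemma measurable_observation:
  fixes x y z :: real
  assumes "p \<in> borel_measurable G"
  shows "(\<lambda>\<omega>. (p \<omega> \<le> x, p \<omega> \<le> y, p \<omega> \<le> z)) \<in> measurable G (count_space (UNIV :: observation set))"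
proof -
  have "(\<lambda>q :: real. (q \<le> x, q \<le> y, q \<le> z)) \<in> measurable borel (count_space UNIV)"
  proof (subst measurable_count_space_eq2_countable, safe)
    fix b c d
    have "(\<lambda>q :: real. (q \<le> x, q \<le> y, q \<le> z)) -` {(b, c, d)} \<inter> space borel =
        {q. (q \<le> x) = b} \<inter> {q. (q \<le> y) = c} \<inter> {q. (q \<le> z) = d}"
      by auto
    also have "\<dots> \<in> sets borel"
      by measurable
    finally show "(\<lambda>q :: real. (q \<le> x, q \<le> y, q \<le> z)) -` {(b, c, d)} \<inter> space borel \<in> sets borel" .
  qed auto
  from measurable_compose[OF assms this] show ?thesis .
qed

lemma length_filter_fst_mono:
  "list_all2 obs_le xs ys \<Longrightarrow> length (filter fst xs) \<le> length (filter fst ys)"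
  by (induction rule: list_all2_induct) (auto simp: obs_le_def split: prod.splits)

text \<open>Replaces a function of three infinite indicator sequences by a function of the list of
  the first \<open>i\<close> observations, which can then be evaluated on a modified history as
  well.\<close>

lemma monotonic_in_past_history:
  assumes "monotonic_in_past M (\<lambda>j \<omega>. of_bool (r j \<omega>)) (\<lambda>j \<omega>. of_bool (c j \<omega>))
    (\<lambda>j \<omega>. of_bool (s j \<omega>)) i Y"
  obtains F where "\<And>xs ys. length xs = i \<Longrightarrow> list_all2 obs_le xs ys \<Longrightarrow> F xs \<le> F ys"
    and "\<And>\<omega>. \<omega> \<in> space M \<Longrightarrow> Y \<omega> = F (map (\<lambda>l. (r l \<omega>, c l \<omega>, s l \<omega>)) [0..<i])"
proof -
  obtain f :: "(nat \<Rightarrow> real) \<Rightarrow> (nat \<Rightarrow> real) \<Rightarrow> (nat \<Rightarrow> real) \<Rightarrow> real" where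
    mono: "\<forall>r r' c c' s s'.
        range r \<union> range r' \<union> range c \<union> range c' \<union> range s \<union> range s' \<subseteq> {0, 1} \<and>
        (\<forall>j<i. r j \<le> r' j \<and> c j \<le> c' j \<and> s' j \<le> s j) \<longrightarrow> f r c s \<le> f r' c' s'"
    and "\<forall>\<omega>\<in>space M.
        Y \<omega> = f (\<lambda>j. of_bool (r j \<omega>)) (\<lambda>j. of_bool (c j \<omega>)) (\<lambda>j. of_bool (s j \<omega>))"
    using assms unfolding monotonic_in_past_def by (elim exE conjE) (rule that)
  note f = mono[rule_format, OF conjI] and Y = this(2)[rule_format]
  \<comment> \<open>Entries beyond the end of the list are unspecified, but \<open>of_bool\<close>
    keeps them in {0, 1}, and only those below \<open>i\<close> are compared.\<close>
  define F where "F xs = f (\<lambda>j. of_bool (fst (xs ! j))) (\<lambda>j. of_bool (fst (snd (xs ! j))))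
    (\<lambda>j. of_bool (snd (snd (xs ! j))))" for xs :: "observation list"
  show thesis
  proof
    fix xs ys assume "length xs = i" "list_all2 obs_le xs ys"
    then have "\<forall>j<i. obs_le (xs ! j) (ys ! j)"
      by (auto simp: list_all2_conv_all_nth)
    then show "F xs \<le> F ys"
      unfolding F_def by (intro f) (auto simp: obs_le_def split_beta)
  next
    fix \<omega> assume \<omega>: "\<omega> \<in> space M"
    \<comment> \<open>The arguments of \<open>f\<close> agree only below \<open>i\<close>;
      monotonicity in both directions gives equality.\<close>
    show "Y \<omega> = F (map (\<lambda>l. (r l \<omega>, c l \<omega>, s l \<omega>)) [0..<i])"
      unfolding F_def Y[OF \<omega>] by (intro antisym f) auto
  qed
qed

section \<open>Runs with one forced observation\<close>

text \<open>Both sides are compared with the number of rejections when the observation at step \<open>j\<close> is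
  forced to the value it has on the event in question. These numbers do not depend on the
  \<open>j\<close>-th p-value, and by monotonicity rejecting at step \<open>j\<close> can only increase them.\<close>

lemma (in prob_space) null_rejection_proportion_bound:
  fixes P \<tau> lam a S C R :: "nat \<Rightarrow> 'a \<Rightarrow> real"
  assumes P_rv: "\<And>i. P i \<in> borel_measurable M"
    and P_le: "\<And>\<omega>. \<omega> \<in> space M \<Longrightarrow> P j \<omega> \<le> 1"
    and valid: "valid_pval M (P j)" "(\<exists>\<omega>\<in>space M. \<tau> j \<omega> < 1) \<Longrightarrow> uniformly_valid_pval M (P j)"
    and indep: "indep_set (sets (pval_sigma M P {j})) (sets (pval_sigma M P (- {j})))"
    and meas: "a j \<in> borel_measurable (pval_sigma M P {..<j})"
      "lam j \<in> borel_measurable (pval_sigma M P {..<j})"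
      "\<tau> j \<in> borel_measurable (pval_sigma M P {..<j})"
    and levels: "\<And>\<omega>. \<omega> \<in> space M \<Longrightarrow>
      0 \<le> a j \<omega> \<and> a j \<omega> \<le> lam j \<omega> \<and> lam j \<omega> < \<tau> j \<omega> \<and> \<tau> j \<omega> \<le> 1"
    and S_def: "S = (\<lambda>j \<omega>. of_bool (P j \<omega> \<le> \<tau> j \<omega>))"
    and C_def: "C = (\<lambda>j \<omega>. of_bool (P j \<omega> \<le> lam j \<omega>))"
    and R_def: "R = (\<lambda>j \<omega>. of_bool (P j \<omega> \<le> a j \<omega>))"
    and mono: "\<And>k. monotonic_in_past M R C S k (a k)" "\<And>k. monotonic_in_past M R C S k (lam k)"
      "\<And>k. monotonic_in_past M R C S k (\<lambda>\<omega>. 1 - \<tau> k \<omega>)"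
    and int: "integrable M (\<lambda>\<omega>. a j \<omega> / (\<tau> j \<omega> - lam j \<omega>) * (S j \<omega> - C j \<omega>))"
    and N_meas: "(\<lambda>\<omega>. real (max (card (rejections R i \<omega>)) 1)) \<in> borel_measurable M"
  shows "(\<integral>\<omega>. R j \<omega> / real (max (card (rejections R i \<omega>)) 1) \<partial>M) \<le>
    (\<integral>\<omega>. a j \<omega> / (\<tau> j \<omega> - lam j \<omega>) * (S j \<omega> - C j \<omega>) / real (max (card (rejections R i \<omega>)) 1) \<partial>M)"
proof -
  define x where "x \<omega> k = (P k \<omega> \<le> a k \<omega>, P k \<omega> \<le> lam k \<omega>, P k \<omega> \<le> \<tau> k \<omega>)" for \<omega> k
  have hist: "\<exists>F. \<forall>k. (\<forall>xs ys. length xs = k \<longrightarrow> list_all2 obs_le xs ys \<longrightarrow> F k xs \<le> F k ys) \<and>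
      (\<forall>\<omega>\<in>space M. Y k \<omega> = F k (map (x \<omega>) [0..<k]))"
    if "\<And>k. monotonic_in_past M R C S k (Y k)" for Y
  proof (intro choice allI)
    fix k
    show "\<exists>F. (\<forall>xs ys. length xs = k \<longrightarrow> list_all2 obs_le xs ys \<longrightarrow> F xs \<le> F ys) \<and>
      (\<forall>\<omega>\<in>space M. Y k \<omega> = F (map (x \<omega>) [0..<k]))"
      using that[of k] unfolding R_def C_def S_def x_def by (elim monotonic_in_past_history) blast
  qed
  from hist[OF mono(1)] obtain A where
    A: "\<And>k xs ys. length xs = k \<Longrightarrow> list_all2 obs_le xs ys \<Longrightarrow> A k xs \<le> A k ys"
      "\<And>k \<omega>. \<omega> \<in> space M \<Longrightarrow> a k \<omega> = A k (map (x \<omega>) [0..<k])"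
    by blast
  from hist[OF mono(2)] obtain L where
    L: "\<And>k xs ys. length xs = k \<Longrightarrow> list_all2 obs_le xs ys \<Longrightarrow> L k xs \<le> L k ys"
      "\<And>k \<omega>. \<omega> \<in> space M \<Longrightarrow> lam k \<omega> = L k (map (x \<omega>) [0..<k])"
    by blast
  from hist[OF mono(3)] obtain T where
    T: "\<And>k xs ys. length xs = k \<Longrightarrow> list_all2 obs_le xs ys \<Longrightarrow> T k xs \<le> T k ys"
      "\<And>k \<omega>. \<omega> \<in> space M \<Longrightarrow> 1 - \<tau> k \<omega> = T k (map (x \<omega>) [0..<k])"
    by blast
  \<comment> \<open>The rule of the actual procedure, with levels written as functions of the past,
    except that the observation at step \<open>j\<close> is replaced by \<open>b\<close>. As
    \<open>T\<close> represents 1 - \<tau>, the third comparison is with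
    \<open>1 - T k xs\<close>.\<close>
  define step where "step b \<omega> k xs =
    (if k = j then b else (P k \<omega> \<le> A k xs, P k \<omega> \<le> L k xs, P k \<omega> \<le> 1 - T k xs))" for b \<omega> k xs
  define N where "N \<omega> = real (max (card (rejections R i \<omega>)) 1)" for \<omega>
  define N' where
    "N' b \<omega> = real (max (length (filter fst (history (step b \<omega>) (Suc i)))) 1)" for b \<omega>
  have N'_ge: "1 \<le> N' b \<omega>" and N_ge: "1 \<le> N \<omega>" for b \<omega>
    by (simp_all add: N'_def N_def)
  \<comment> \<open>Where the observation at \<open>j\<close> already is \<open>b\<close>, forcing
    it changes nothing, so the forced run is the actual one.\<close>
  have N_eq: "N \<omega> = N' b \<omega>" if \<omega>: "\<omega> \<in> space M" and b: "x \<omega> j = b" for \<omega> b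
  proof -
    have "x \<omega> k = step b \<omega> k (map (x \<omega>) [0..<k])" for k
      using b A(2)[OF \<omega>, of k] L(2)[OF \<omega>, of k] T(2)[OF \<omega>, of k]
      by (cases "k = j") (auto simp: step_def x_def[of \<omega> k])
    then have "history (step b \<omega>) (Suc i) = map (x \<omega>) [0..<Suc i]"
      by (rule history_eq)
    moreover have "card (rejections R i \<omega>) = length (filter fst (map (x \<omega>) [0..<Suc i]))"
      unfolding length_filter_conv_card rejections_def R_def
      by (intro arg_cong[where f = card]) (auto simp: x_def less_Suc_eq_le simp del: upt_Suc)
    ultimately show ?thesis
      by (simp only: N_def N'_def)
  qed
  \<comment> \<open>The first triple is what is observed if P lies above \<lambda> and not above
    \<tau>, the second what is observed at a rejection. The former is the smaller one for
    \<open>obs_le\<close>, and the order persists in all later steps.\<close>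
  have N'_mono: "N' (False, False, True) \<omega> \<le> N' (True, True, True) \<omega>" for \<omega>
  proof -
    have "list_all2 obs_le (history (step (False, False, True) \<omega>) (Suc i))
        (history (step (True, True, True) \<omega>) (Suc i))"
    proof (rule history_mono)
      fix k xs ys assume "length xs = k" "list_all2 obs_le xs ys"
      then show "obs_le (step (False, False, True) \<omega> k xs) (step (True, True, True) \<omega> k ys)"
        using A(1)[of xs k ys] L(1)[of xs k ys] T(1)[of xs k ys] by (auto simp: step_def obs_le_def)
    qed
    from length_filter_fst_mono[OF this] show ?thesis
      unfolding N'_def by (simp only: of_nat_le_iff max.mono order_refl)
  qed
  \<comment> \<open>\<open>P j\<close> could enter only at step \<open>j\<close>, where the rule is
    constant.\<close>
  have hist_meas: "(\<lambda>\<omega>. history (step b \<omega>) n) \<in>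
      measurable (pval_sigma M P (- {j})) (count_space UNIV)" for b n
  proof (rule measurable_history)
    fix k xs
    show "(\<lambda>\<omega>. step b \<omega> k xs) \<in> measurable (pval_sigma M P (- {j})) (count_space UNIV)"
      by (cases "k = j")
         (simp_all add: step_def measurable_observation measurable_pval_sigma)
  qed
  have N'_meas: "(\<lambda>\<omega>. N' b \<omega>) \<in> borel_measurable (pval_sigma M P (- {j}))" for b
    unfolding N'_def by (rule measurable_compose[OF hist_meas]) simp
  have G: "subalgebra M (pval_sigma M P J)" for J
    using P_rv by (rule subalgebra_pval_sigma)
  note meas_M = meas[THEN measurable_from_subalg[OF G]]
  note [measurable] = meas_M P_rv N'_meas[THEN measurable_from_subalg[OF G]] N_meas[folded N_def]
  define Z where "Z \<omega> = a j \<omega> / (\<tau> j \<omega> - lam j \<omega>) * of_bool (lam j \<omega> < P j \<omega> \<and> P j \<omega> \<le> \<tau> j \<omega>)"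
    for \<omega>
  have SC: "a j \<omega> / (\<tau> j \<omega> - lam j \<omega>) * (S j \<omega> - C j \<omega>) = Z \<omega>" if "\<omega> \<in> space M" for \<omega>
    using levels[OF that] by (auto simp: Z_def S_def C_def)
  have Z0: "0 \<le> Z \<omega>" if "\<omega> \<in> space M" for \<omega>
    using levels[OF that] by (auto simp: Z_def)
  have [measurable]: "Z \<in> borel_measurable M"
    unfolding Z_def by measurable
  have intZ: "integrable M Z"
    using int by (subst (asm) Bochner_Integration.integrable_cong[OF refl SC]) auto
  have int_div: "integrable M (\<lambda>\<omega>. Z \<omega> * (1 / f \<omega>))"
    if [measurable]: "f \<in> borel_measurable M" and f: "\<And>\<omega>. 1 \<le> f \<omega>" for f
  proof (rule Bochner_Integration.integrable_bound[OF intZ])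
    have "\<bar>Z \<omega>\<bar> / \<bar>f \<omega>\<bar> \<le> \<bar>Z \<omega>\<bar> / 1" for \<omega>
      using f[of \<omega>] by (intro divide_left_mono) auto
    then show "AE \<omega> in M. norm (Z \<omega> * (1 / f \<omega>)) \<le> norm (Z \<omega>)"
      by simp
  qed measurable
  let ?v = "\<lambda>\<omega>. 1 / N' (True, True, True) \<omega>"
  \<comment> \<open>At a rejection P \<le> a \<le> \<lambda> < \<tau>, so all three components of
    the observation are true and the count may be replaced by the forced one.\<close>
  have "(\<integral>\<omega>. R j \<omega> / N \<omega> \<partial>M) = (\<integral>\<omega>. of_bool (P j \<omega> \<le> a j \<omega>) * ?v \<omega> \<partial>M)"
  proof (rule Bochner_Integration.integral_cong[OF refl])
    fix \<omega> assume "\<omega> \<in> space M"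
    then show "R j \<omega> / N \<omega> = of_bool (P j \<omega> \<le> a j \<omega>) * ?v \<omega>"
      using levels[of \<omega>] N_eq[of \<omega> "(True, True, True)"] by (auto simp: R_def x_def)
  qed
  also have "\<dots> \<le> (\<integral>\<omega>. Z \<omega> * ?v \<omega> \<partial>M)"
    unfolding Z_def
  proof (rule null_rejection_bound[OF P_rv P_le valid G])
    show "indep_set (sigma_sets (space M) {P j -` A \<inter> space M |A. A \<in> sets borel})
        (sets (pval_sigma M P (- {j})))"
      using indep by (simp add: sets_pval_sigma[of M P "{j}"])
    show "a j \<in> borel_measurable (pval_sigma M P (- {j}))"
      "lam j \<in> borel_measurable (pval_sigma M P (- {j}))"
      "\<tau> j \<in> borel_measurable (pval_sigma M P (- {j}))"
      using meas by (auto elim!: pval_sigma_mono)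
    show "integrable M (\<lambda>\<omega>. of_bool (P j \<omega> \<le> a j \<omega>) * ?v \<omega>)"
    proof (rule integrable_const_bound[of _ 1], rule AE_I2)
      fix \<omega>
      show "norm (of_bool (P j \<omega> \<le> a j \<omega>) * ?v \<omega>) \<le> 1"
        using N'_ge[of "(True, True, True)" \<omega>] by auto
    qed measurable
    show "integrable M (\<lambda>\<omega>. a j \<omega> / (\<tau> j \<omega> - lam j \<omega>) *
        of_bool (lam j \<omega> < P j \<omega> \<and> P j \<omega> \<le> \<tau> j \<omega>) * ?v \<omega>)"
      unfolding Z_def[symmetric] by (rule int_div) (use N'_ge in auto)
  qed (use levels N'_meas N'_ge in \<open>auto simp: order_trans[OF zero_le_one]\<close>)
  also have "\<dots> \<le> (\<integral>\<omega>. Z \<omega> * (1 / N' (False, False, True) \<omega>) \<partial>M)"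
  proof (rule integral_mono)
    fix \<omega> assume "\<omega> \<in> space M"
    then show "Z \<omega> * ?v \<omega> \<le> Z \<omega> * (1 / N' (False, False, True) \<omega>)"
      using Z0 N'_mono[of \<omega>] N'_ge[of "(False, False, True)" \<omega>]
      by (intro mult_left_mono divide_left_mono) auto
  qed (rule int_div, measurable, rule N'_ge)+
  \<comment> \<open>\<open>Z\<close> vanishes unless P lies above \<lambda> and not above \<tau>;
    there nothing is rejected at \<open>j\<close>, because a \<le> \<lambda>, and the forced count
    is the actual one again.\<close>
  also have "\<dots> = (\<integral>\<omega>. a j \<omega> / (\<tau> j \<omega> - lam j \<omega>) * (S j \<omega> - C j \<omega>) / N \<omega> \<partial>M)"
  proof (rule Bochner_Integration.integral_cong[OF refl])
    fix \<omega> assume \<omega>: "\<omega> \<in> space M"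
    show "Z \<omega> * (1 / N' (False, False, True) \<omega>) =
        a j \<omega> / (\<tau> j \<omega> - lam j \<omega>) * (S j \<omega> - C j \<omega>) / N \<omega>"
      using levels[of \<omega>] \<omega> N_eq[of \<omega> "(False, False, True)"] unfolding SC[OF \<omega>]
      by (auto simp: Z_def x_def)
  qed
  finally show ?thesis
    unfolding N_def .
qed

section \<open>The budget applied to the procedure along each outcome\<close>

text \<open>Conflicting terms are zero and the others non-negative, so the infinite sums that bound
  the graph weights also bound the partial sums needed in \<open>addis_graph\<close>.\<close>

lemma sum_greaterThanAtMost_le_infsum:
  fixes f :: "nat \<Rightarrow> real"
  assumes "\<And>k. j < k \<Longrightarrow> 0 \<le> f k" "\<And>k. Q k \<Longrightarrow> f k = 0" "f summable_on {k. j < k \<and> \<not> Q k}"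
  shows "(\<Sum>k\<in>{j<..i}. f k) \<le> (\<Sum>\<^sub>\<infinity>k\<in>{k. j < k \<and> \<not> Q k}. f k)"
proof -
  have "(\<Sum>k\<in>{j<..i}. f k) = (\<Sum>k\<in>{k\<in>{j<..i}. \<not> Q k}. f k)"
    using assms(2) by (intro sum.mono_neutral_right) auto
  also have "\<dots> \<le> (\<Sum>\<^sub>\<infinity>k\<in>{k. j < k \<and> \<not> Q k}. f k)"
    using assms by (intro finite_sum_le_infsum) auto
  finally show ?thesis .
qed

theorem theoremC1:
  fixes M :: "'a measure" and P :: "nat \<Rightarrow> 'a \<Rightarrow> real" and I0 :: "nat set"
    and X :: "nat \<Rightarrow> nat set" and \<alpha> W0 :: real
    and \<gamma> \<tau> lam ahat a S C R K :: "nat \<Rightarrow> 'a \<Rightarrow> real"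
    and g h :: "nat \<Rightarrow> nat \<Rightarrow> 'a \<Rightarrow> real"
  assumes "prob_space M"
    and P_rv: "\<And>i. P i \<in> borel_measurable M"
    and P_01: "\<And>i \<omega>. \<omega> \<in> space M \<Longrightarrow> P i \<omega> \<in> {0..1}"
    and null_valid: "\<And>i. i \<in> I0 \<Longrightarrow> valid_pval M (P i)"
    and null_uniformly_valid:
      "\<And>i. i \<in> I0 \<Longrightarrow> (\<exists>\<omega>\<in>space M. \<tau> i \<omega> < 1) \<Longrightarrow> uniformly_valid_pval M (P i)"
    and X: "conflict_sets M P X" "monotone_conflict_sets X"
    and \<alpha>: "0 < \<alpha>" "\<alpha> < 1" and W0: "0 \<le> W0" "W0 \<le> \<alpha>"
    and \<gamma>: "\<And>i \<omega>. \<omega> \<in> space M \<Longrightarrow> 0 \<le> \<gamma> i \<omega>"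
           "\<And>\<omega>. \<omega> \<in> space M \<Longrightarrow> (\<lambda>i. \<gamma> i \<omega>) sums 1"
    and g: "\<And>i j \<omega>. \<omega> \<in> space M \<Longrightarrow> j < i \<Longrightarrow> 0 \<le> g j i \<omega>"
           "\<And>i j \<omega>. \<omega> \<in> space M \<Longrightarrow> j \<in> X i \<Longrightarrow> g j i \<omega> = 0"
           "\<And>j \<omega>. \<omega> \<in> space M \<Longrightarrow> (\<lambda>i. g j i \<omega>) summable_on {i. j < i \<and> j \<notin> X i}"
           "\<And>j \<omega>. \<omega> \<in> space M \<Longrightarrow> (\<Sum>\<^sub>\<infinity>i\<in>{i. j < i \<and> j \<notin> X i}. g j i \<omega>) \<le> 1"
    and h: "\<And>i j \<omega>. \<omega> \<in> space M \<Longrightarrow> j < i \<Longrightarrow> 0 \<le> h j i \<omega>"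
           "\<And>i j \<omega>. \<omega> \<in> space M \<Longrightarrow> j \<in> X i \<Longrightarrow> h j i \<omega> = 0"
           "\<And>j \<omega>. \<omega> \<in> space M \<Longrightarrow> (\<lambda>i. h j i \<omega>) summable_on {i. j < i \<and> j \<notin> X i}"
           "\<And>j \<omega>. \<omega> \<in> space M \<Longrightarrow> (\<Sum>\<^sub>\<infinity>i\<in>{i. j < i \<and> j \<notin> X i}. h j i \<omega>) \<le> 1"
    and \<tau>: "\<And>i \<omega>. \<omega> \<in> space M \<Longrightarrow> 0 < \<tau> i \<omega> \<and> \<tau> i \<omega> \<le> 1"
    and lam: "\<And>i \<omega>. \<omega> \<in> space M \<Longrightarrow> 0 \<le> lam i \<omega> \<and> lam i \<omega> < \<tau> i \<omega>"
    and \<gamma>_meas: "\<And>i. \<gamma> i \<in> borel_measurable (pval_sigma M P ({..<i} - X i))"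
    and g_meas: "\<And>i j. j < i \<Longrightarrow> g j i \<in> borel_measurable (pval_sigma M P ({..<i} - X i))"
    and \<tau>_meas: "\<And>i. \<tau> i \<in> borel_measurable (pval_sigma M P ({..<i} - X i))"
    and lam_meas: "\<And>i. lam i \<in> borel_measurable (pval_sigma M P ({..<i} - X i))"
    and S_def: "S = (\<lambda>j \<omega>. of_bool (P j \<omega> \<le> \<tau> j \<omega>))"
    and C_def: "C = (\<lambda>j \<omega>. of_bool (P j \<omega> \<le> lam j \<omega>))"
    and R_def: "R = (\<lambda>j \<omega>. of_bool (P j \<omega> \<le> a j \<omega>))"
    and K_def: "K = (\<lambda>j \<omega>. of_bool (\<exists>k<j. R k \<omega> = 1))"
    and a_def: "a = (\<lambda>i \<omega>. min (ahat i \<omega>) (lam i \<omega>))"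
    and ahat: "\<And>i \<omega>. \<omega> \<in> space M \<Longrightarrow>
       ahat i \<omega> = (\<tau> i \<omega> - lam i \<omega>) *
         (W0 * \<gamma> i \<omega>
          + (\<Sum>j<i. g j i \<omega> * (C j \<omega> - S j \<omega> + 1) * (ahat j \<omega> / (\<tau> j \<omega> - lam j \<omega>)))
          + (\<Sum>j<i. h j i \<omega> * R j \<omega> * (\<alpha> * K j \<omega> + (\<alpha> - W0) * (1 - K j \<omega>))))"
    and a_past: "\<And>i. a i \<in> borel_measurable (pval_sigma M P {..<i})"
  shows
    "(\<forall>i. \<forall>\<omega>\<in>space M.
        (\<Sum>j\<le>i. a j \<omega> / (\<tau> j \<omega> - lam j \<omega>) * (S j \<omega> - C j \<omega>))
          / real (max (card (rejections R i \<omega>)) 1) \<le> \<alpha>)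
     \<and>
     ((\<forall>i. \<forall>j<i. (\<lambda>\<omega>. h j i \<omega> * R j \<omega> * (\<alpha> * K j \<omega> + (\<alpha> - W0) * (1 - K j \<omega>)))
                    \<in> borel_measurable (pval_sigma M P ({..<i} - X i)))
        \<longrightarrow> (\<forall>i. mFDR M I0 R i \<le> \<alpha>))
     \<and>
     ((\<forall>i. monotonic_in_past M R C S i (a i)
           \<and> monotonic_in_past M R C S i (lam i)
           \<and> monotonic_in_past M R C S i (\<lambda>\<omega>. 1 - \<tau> i \<omega>))
      \<and> prob_space.indep_vars M (\<lambda>_. borel) P I0
      \<and> prob_space.indep_set M (sets (pval_sigma M P I0)) (sets (pval_sigma M P (- I0)))
        \<longrightarrow> (\<forall>i. FDR M I0 R i \<le> \<alpha>))"
proof -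
  interpret prob_space M by fact
  define G where "G i = pval_sigma M P ({..<i} - X i)" for i
  define rew where "rew j \<omega> = R j \<omega> * (\<alpha> * K j \<omega> + (\<alpha> - W0) * (1 - K j \<omega>))" for j \<omega>
  \<comment> \<open>Division by \<tau> - \<lambda> turns the recursion for \<open>ahat\<close> into
    that of \<open>addis_graph\<close>.\<close>
  define w where "w j \<omega> = ahat j \<omega> / (\<tau> j \<omega> - lam j \<omega>)" for j \<omega>
  define N where "N i \<omega> = real (max (card (rejections R i \<omega>)) 1)" for i \<omega>
  define Z where "Z j \<omega> = a j \<omega> / (\<tau> j \<omega> - lam j \<omega>) * (S j \<omega> - C j \<omega>)" for j \<omega>
  have N_ge: "1 \<le> N i \<omega>" for i \<omega>
    by (simp add: N_def)
  have SC: "S j \<omega> - C j \<omega> \<in> {0, 1}" if "\<omega> \<in> space M" for j \<omega>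
    using lam[OF that, of j] by (auto simp: S_def C_def)
  have g_le: "(\<Sum>k\<in>{j<..i}. g j k \<omega>) \<le> 1" and h_le: "(\<Sum>k\<in>{j<..i}. h j k \<omega>) \<le> 1"
    if \<omega>: "\<omega> \<in> space M" for j i \<omega>
    using g[OF \<omega>] h[OF \<omega>]
    by (auto intro!: sum_greaterThanAtMost_le_infsum[where Q = "\<lambda>k. j \<in> X k", THEN order_trans])
  have budget: "0 \<le> w i \<omega>" "(\<Sum>j\<le>i. w j \<omega> * (S j \<omega> - C j \<omega>)) \<le> \<alpha> * N i \<omega>"
    if \<omega>: "\<omega> \<in> space M" for i \<omega>
  proof -
    define B where "B = {j. R j \<omega> = 1}"
    have rew: "rew j \<omega> = of_bool (j \<in> B) *
        (\<alpha> * of_bool (\<exists>k<j. k \<in> B) + (\<alpha> - W0) * (1 - of_bool (\<exists>k<j. k \<in> B)))" for j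
      by (auto simp: rew_def B_def R_def K_def)
    have w: "w i \<omega> = W0 * \<gamma> i \<omega> + (\<Sum>j<i. g j i \<omega> * (C j \<omega> - S j \<omega> + 1) * w j \<omega>) +
        (\<Sum>j<i. h j i \<omega> * (of_bool (j \<in> B) *
        (\<alpha> * of_bool (\<exists>k<j. k \<in> B) + (\<alpha> - W0) * (1 - of_bool (\<exists>k<j. k \<in> B)))))" for i
      using lam[OF \<omega>, of i] unfolding w_def ahat[OF \<omega>, of i] rew[symmetric] rew_def
      by (simp add: mult.assoc)
    have \<gamma>1: "(\<Sum>j\<le>i. \<gamma> j \<omega>) \<le> 1" for i
      using \<gamma>(2)[OF \<omega>] \<gamma>(1)[OF \<omega>] sum_le_suminf[of "\<lambda>i. \<gamma> i \<omega>" "{..i}"]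
      by (auto simp: sums_iff)
    have u: "C j \<omega> - S j \<omega> + 1 \<in> {0, 1}" for j
      using SC[OF \<omega>, of j] by auto
    note graph = addis_graph[where w = "\<lambda>j. w j \<omega>" and u = "\<lambda>j. C j \<omega> - S j \<omega> + 1"
        and \<gamma> = "\<lambda>j. \<gamma> j \<omega>" and g = "\<lambda>j i. g j i \<omega>" and h = "\<lambda>j i. h j i \<omega>",
        OF W0 \<gamma>(1)[OF \<omega>] \<gamma>1 g(1)[OF \<omega>] g_le[OF \<omega>] h(1)[OF \<omega>] h_le[OF \<omega>] u w]
    show "0 \<le> w i \<omega>"
      by (rule graph(1))
    have "rejections R i \<omega> = {j\<in>B. j \<le> i}"
      by (auto simp: rejections_def B_def)
    then show "(\<Sum>j\<le>i. w j \<omega> * (S j \<omega> - C j \<omega>)) \<le> \<alpha> * N i \<omega>"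
      using graph(2)[of i] by (simp add: N_def algebra_simps)
  qed
  have levels: "0 \<le> a j \<omega> \<and> a j \<omega> \<le> lam j \<omega> \<and> lam j \<omega> < \<tau> j \<omega> \<and> \<tau> j \<omega> \<le> 1"
    if \<omega>: "\<omega> \<in> space M" for j \<omega>
  proof -
    have "0 \<le> ahat j \<omega>"
      using budget(1)[OF \<omega>, of j] lam[OF \<omega>, of j] by (auto simp: w_def zero_le_divide_iff)
    then show ?thesis
      using lam[OF \<omega>, of j] \<tau>[OF \<omega>, of j] by (auto simp: a_def)
  qed
  have Z0: "0 \<le> Z j \<omega>" if "\<omega> \<in> space M" for j \<omega>
    using levels[OF that, of j] SC[OF that, of j] by (auto simp: Z_def)
  have sum_Z: "(\<Sum>j\<le>i. Z j \<omega>) \<le> \<alpha> * N i \<omega>" if \<omega>: "\<omega> \<in> space M" for i \<omega>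
  proof -
    \<comment> \<open>Truncation at \<open>lam\<close> only lowers the level, so the budget for
      \<open>ahat\<close> also covers \<open>a\<close>.\<close>
    have "Z j \<omega> \<le> w j \<omega> * (S j \<omega> - C j \<omega>)" for j
      using lam[OF \<omega>, of j] SC[OF \<omega>, of j] unfolding Z_def w_def
      by (intro mult_right_mono divide_right_mono) (auto simp: a_def)
    then have "(\<Sum>j\<le>i. Z j \<omega>) \<le> (\<Sum>j\<le>i. w j \<omega> * (S j \<omega> - C j \<omega>))"
      by (intro sum_mono)
    with budget(2)[OF \<omega>, of i] show ?thesis
      by linarith
  qed
  have sum_null_Z: "(\<Sum>j\<in>I0 \<inter> {..i}. Z j \<omega>) \<le> \<alpha> * N i \<omega>" if "\<omega> \<in> space M" for i \<omega>
  proof -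
    have "(\<Sum>j\<in>I0 \<inter> {..i}. Z j \<omega>) \<le> (\<Sum>j\<le>i. Z j \<omega>)"
      using Z0[OF that] by (intro sum_mono2) auto
    with sum_Z[OF that, of i] show ?thesis
      by linarith
  qed

  \<comment> \<open>The pathwise bound (a)\<close>
  have part_a: "\<forall>i. \<forall>\<omega>\<in>space M. (\<Sum>j\<le>i. Z j \<omega>) / N i \<omega> \<le> \<alpha>"
  proof (intro allI ballI)
    fix i \<omega> assume "\<omega> \<in> space M"
    with sum_Z[of \<omega> i] N_ge[of i \<omega>] show "(\<Sum>j\<le>i. Z j \<omega>) / N i \<omega> \<le> \<alpha>"
      by (simp add: divide_le_eq)
  qed

  \<comment> \<open>Measurability and integrability\<close>
  have subalg: "subalgebra M (pval_sigma M P J)" for J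
    using P_rv by (rule subalgebra_pval_sigma)
  note [measurable] = P_rv a_past[THEN measurable_from_subalg[OF subalg]]
    \<tau>_meas[THEN measurable_from_subalg[OF subalg]] lam_meas[THEN measurable_from_subalg[OF subalg]]
  have R_meas [measurable]: "R j \<in> borel_measurable M" for j
    unfolding R_def by measurable
  have Z_meas [measurable]: "Z j \<in> borel_measurable M" for j
    unfolding Z_def S_def C_def by measurable
  have card_rej: "real (card (J \<inter> rejections R i \<omega>)) = (\<Sum>j\<in>J \<inter> {..i}. R j \<omega>)" for J i \<omega>
  proof -
    have "(\<Sum>j\<in>J \<inter> {..i}. R j \<omega>) = (\<Sum>j\<in>J \<inter> rejections R i \<omega>. 1)"
      by (intro sum.mono_neutral_cong_right) (auto simp: rejections_def R_def)
    then show ?thesis by simp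
  qed
  have N_eq: "N i = (\<lambda>\<omega>. max (\<Sum>j\<le>i. R j \<omega>) 1)" for i
    using card_rej[of UNIV i] by (simp add: N_def[abs_def] of_nat_max)
  have N_meas [measurable]: "N i \<in> borel_measurable M" for i
    unfolding N_eq by measurable
  have N_le: "N i \<omega> \<le> real i + 1" for i \<omega>
  proof -
    have "(\<Sum>j\<le>i. R j \<omega>) \<le> (\<Sum>j\<le>i. 1)"
      by (intro sum_mono) (simp add: R_def)
    then show ?thesis by (simp add: N_eq)
  qed
  have N_int: "integrable M (N i)" for i
    using N_ge N_le by (intro integrable_const_bound[of _ "real i + 1"]) (auto intro!: AE_I2 simp: N_def)
  have R_int: "integrable M (R j)" for j
    by (intro integrable_const_bound[of _ 1]) (auto simp: R_def)
  \<comment> \<open>The gap \<tau> - \<lambda> may be arbitrarily small, so the quotient in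
    \<open>Z\<close> has no evident bound. The budget supplies one: at most \<open>\<alpha>\<close>
    times the \<open>j + 1\<close> steps from 0 to \<open>j\<close>.\<close>
  have Z_int: "integrable M (Z j)" for j
  proof (rule integrable_const_bound[of _ "\<alpha> * (real j + 1)"])
    show "AE \<omega> in M. norm (Z j \<omega>) \<le> \<alpha> * (real j + 1)"
    proof (rule AE_I2)
      fix \<omega> assume \<omega>: "\<omega> \<in> space M"
      have "Z j \<omega> \<le> (\<Sum>k\<le>j. Z k \<omega>)"
        using Z0[OF \<omega>] by (intro member_le_sum) auto
      also have "\<dots> \<le> \<alpha> * N j \<omega>"
        by (rule sum_Z[OF \<omega>])
      also have "\<dots> \<le> \<alpha> * (real j + 1)"
        using N_le \<alpha> by (intro mult_left_mono) auto
      finally show "norm (Z j \<omega>) \<le> \<alpha> * (real j + 1)"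
        using Z0[OF \<omega>, of j] by simp
    qed
  qed measurable
  have P_le: "P j \<omega> \<le> 1" if "\<omega> \<in> space M" for j \<omega>
    using P_01[OF that, of j] by simp

  \<comment> \<open>Control of the mFDR\<close>
  have part_b: "mFDR M I0 R i \<le> \<alpha>"
    if h_meas: "\<forall>i. \<forall>j<i. (\<lambda>\<omega>. h j i \<omega> * R j \<omega> * (\<alpha> * K j \<omega> + (\<alpha> - W0) * (1 - K j \<omega>)))
      \<in> borel_measurable (pval_sigma M P ({..<i} - X i))" for i
  proof -
    note [measurable] = \<gamma>_meas[folded G_def] g_meas[folded G_def] \<tau>_meas[folded G_def]
      lam_meas[folded G_def]
    \<comment> \<open>An index k < j in \<open>X i\<close> would, by monotonicity of the conflict
      sets, also lie in \<open>X j\<close>; so the non-conflicting past of \<open>j\<close> is part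
      of that of \<open>i\<close>.\<close>
    have G_mono: "f \<in> borel_measurable (G i)" if "f \<in> borel_measurable (G j)" "j < i" "j \<notin> X i"
      for f :: "'a \<Rightarrow> real" and i j
    proof -
      have "{..<j} - X j \<subseteq> {..<i} - X i"
        using X(2) that(2) unfolding monotone_conflict_sets_def by auto
      with that(1) show ?thesis
        unfolding G_def by (rule pval_sigma_mono)
    qed
    have ahat_meas: "ahat i \<in> borel_measurable (G i)" for i
    proof (induction i rule: less_induct)
      case (less i)
      have g_term: "(\<lambda>\<omega>. g j i \<omega> * (C j \<omega> - S j \<omega> + 1) * (ahat j \<omega> / (\<tau> j \<omega> - lam j \<omega>)))
          \<in> borel_measurable (G i)" if "j < i" for j
      \<comment> \<open>For conflicting \<open>j\<close> the indicators at \<open>j\<close> need not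
        be measurable with respect to \<open>G i\<close>, but \<open>g j i\<close> is zero.\<close>
      proof (cases "j \<in> X i")
        case True
        then have "g j i \<omega> * (C j \<omega> - S j \<omega> + 1) * (ahat j \<omega> / (\<tau> j \<omega> - lam j \<omega>)) = 0"
          if "\<omega> \<in> space (G i)" for \<omega>
          using g(2)[of \<omega> j i] that by (simp add: G_def)
        then show ?thesis
          by (subst measurable_cong[where g = "\<lambda>_. 0"]) (simp_all only: measurable_const space_borel UNIV_I)
      next
        case False
        have [measurable]: "g j i \<in> borel_measurable (G i)" "ahat j \<in> borel_measurable (G i)"
          "\<tau> j \<in> borel_measurable (G i)" "lam j \<in> borel_measurable (G i)"
          using that g_meas[folded G_def] less \<tau>_meas[folded G_def] lam_meas[folded G_def]
          by (auto intro: G_mono[OF _ that False])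
        have [measurable]: "P j \<in> borel_measurable (G i)"
          using that False unfolding G_def by (intro measurable_pval_sigma) auto
        show ?thesis
          unfolding S_def C_def by measurable
      qed
      \<comment> \<open>\<open>K j\<close> involves all rejections before \<open>j\<close>, also
        those at steps conflicting with \<open>i\<close>. The measurability of the whole products is
        the premise \<open>h_meas\<close>.\<close>
      have h_term: "(\<lambda>\<omega>. h j i \<omega> * R j \<omega> * (\<alpha> * K j \<omega> + (\<alpha> - W0) * (1 - K j \<omega>)))
          \<in> borel_measurable (G i)" if "j < i" for j
        using h_meas that by (simp add: G_def)
      have g_sum: "(\<lambda>\<omega>. \<Sum>j<i. g j i \<omega> * (C j \<omega> - S j \<omega> + 1) * (ahat j \<omega> / (\<tau> j \<omega> - lam j \<omega>)))
          \<in> borel_measurable (G i)"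
        by (rule borel_measurable_sum) (simp only: lessThan_iff g_term)
      have h_sum: "(\<lambda>\<omega>. \<Sum>j<i. h j i \<omega> * R j \<omega> * (\<alpha> * K j \<omega> + (\<alpha> - W0) * (1 - K j \<omega>)))
          \<in> borel_measurable (G i)"
        by (rule borel_measurable_sum) (simp only: lessThan_iff h_term)
      have "(\<lambda>\<omega>. (\<tau> i \<omega> - lam i \<omega>) * (W0 * \<gamma> i \<omega>
          + (\<Sum>j<i. g j i \<omega> * (C j \<omega> - S j \<omega> + 1) * (ahat j \<omega> / (\<tau> j \<omega> - lam j \<omega>)))
          + (\<Sum>j<i. h j i \<omega> * R j \<omega> * (\<alpha> * K j \<omega> + (\<alpha> - W0) * (1 - K j \<omega>)))))
          \<in> borel_measurable (G i)"
        by (intro borel_measurable_times borel_measurable_add borel_measurable_diff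
            borel_measurable_const g_sum h_sum \<gamma>_meas[folded G_def] \<tau>_meas[folded G_def]
            lam_meas[folded G_def])
      then show ?case
        by (subst measurable_cong[OF ahat]) (simp_all add: G_def)
    qed
    have a_meas: "a j \<in> borel_measurable (G j)" for j
      using ahat_meas[of j] unfolding a_def by measurable
    \<comment> \<open>The non-conflicting past \<open>G j\<close> is independent of
      \<open>P j\<close> and determines the three levels at \<open>j\<close>, so the bound applies
      with weight 1.\<close>
    have null: "(\<integral>\<omega>. R j \<omega> \<partial>M) \<le> (\<integral>\<omega>. Z j \<omega> \<partial>M)" if j: "j \<in> I0" for j
    proof -
      have Z_eq: "Z j \<omega> = a j \<omega> / (\<tau> j \<omega> - lam j \<omega>) * of_bool (lam j \<omega> < P j \<omega> \<and> P j \<omega> \<le> \<tau> j \<omega>) * 1"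
        if "\<omega> \<in> space M" for \<omega>
        using lam[OF that, of j] by (auto simp: Z_def S_def C_def)
      have "(\<integral>\<omega>. of_bool (P j \<omega> \<le> a j \<omega>) * 1 \<partial>M) \<le> (\<integral>\<omega>. a j \<omega> / (\<tau> j \<omega> - lam j \<omega>) *
          of_bool (lam j \<omega> < P j \<omega> \<and> P j \<omega> \<le> \<tau> j \<omega>) * 1 \<partial>M)"
      proof (rule null_rejection_bound[OF P_rv P_le null_valid[OF j] null_uniformly_valid[OF j]])
        show "subalgebra M (G j)"
          unfolding G_def by (rule subalg)
        show "indep_set (sigma_sets (space M) {P j -` A \<inter> space M |A. A \<in> sets borel}) (sets (G j))"
          using X(1)[unfolded conflict_sets_def, rule_format, of j]
          by (simp add: G_def sets_pval_sigma[of M P "{j}"])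
        show "integrable M (\<lambda>\<omega>. of_bool (P j \<omega> \<le> a j \<omega>) * (1 :: real))"
          using R_int[of j] by (simp add: R_def)
        show "integrable M (\<lambda>\<omega>. a j \<omega> / (\<tau> j \<omega> - lam j \<omega>) *
            of_bool (lam j \<omega> < P j \<omega> \<and> P j \<omega> \<le> \<tau> j \<omega>) * 1)"
          using Z_int[of j] by (subst Bochner_Integration.integrable_cong[OF refl Z_eq[symmetric]])
      qed (use a_meas levels \<tau>_meas lam_meas in \<open>auto simp: G_def\<close>)
      also have "\<dots> = (\<integral>\<omega>. Z j \<omega> \<partial>M)"
        by (intro Bochner_Integration.integral_cong refl Z_eq[symmetric])
      finally show ?thesis
        by (simp add: R_def)
    qed
    have "(\<integral>\<omega>. real (card (I0 \<inter> rejections R i \<omega>)) \<partial>M) = (\<Sum>j\<in>I0 \<inter> {..i}. (\<integral>\<omega>. R j \<omega> \<partial>M))"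
      unfolding card_rej using R_int by (rule Bochner_Integration.integral_sum)
    also have "\<dots> \<le> (\<Sum>j\<in>I0 \<inter> {..i}. (\<integral>\<omega>. Z j \<omega> \<partial>M))"
      using null by (intro sum_mono) auto
    also have "\<dots> = (\<integral>\<omega>. (\<Sum>j\<in>I0 \<inter> {..i}. Z j \<omega>) \<partial>M)"
      using Z_int by (rule Bochner_Integration.integral_sum[symmetric])
    also have "\<dots> \<le> (\<integral>\<omega>. \<alpha> * N i \<omega> \<partial>M)"
      using Z_int N_int sum_null_Z by (intro integral_mono) auto
    finally have le: "(\<integral>\<omega>. real (card (I0 \<inter> rejections R i \<omega>)) \<partial>M) \<le> \<alpha> * (\<integral>\<omega>. N i \<omega> \<partial>M)"
      by simp
    have "1 \<le> (\<integral>\<omega>. N i \<omega> \<partial>M)"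
      using N_int N_ge by (intro integral_ge_const) auto
    with le show ?thesis
      unfolding mFDR_def N_def[symmetric] by (simp add: divide_le_eq)
  qed

  \<comment> \<open>Control of the FDR\<close>
  have part_c: "FDR M I0 R i \<le> \<alpha>"
    if mono: "\<forall>i. monotonic_in_past M R C S i (a i) \<and> monotonic_in_past M R C S i (lam i) \<and>
        monotonic_in_past M R C S i (\<lambda>\<omega>. 1 - \<tau> i \<omega>)"
      and nulls: "indep_vars (\<lambda>_. borel) P I0"
      and rest: "indep_set (sets (pval_sigma M P I0)) (sets (pval_sigma M P (- I0)))" for i
  proof -
    have div_int: "integrable M (\<lambda>\<omega>. f \<omega> / N i \<omega>)" if f: "integrable M f" for f
    proof (rule Bochner_Integration.integrable_bound[OF f])
      have "\<bar>f \<omega>\<bar> / \<bar>N i \<omega>\<bar> \<le> \<bar>f \<omega>\<bar> / 1" for \<omega>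
        using N_ge[of i \<omega>] by (intro divide_left_mono) auto
      then show "AE \<omega> in M. norm (f \<omega> / N i \<omega>) \<le> norm (f \<omega>)"
        by simp
    qed (use f in measurable)
    \<comment> \<open>Here \<open>P j\<close> is independent of all other p-values, later ones
      included, so the random denominator \<open>N i\<close> can be kept inside the
      expectation.\<close>
    have null: "(\<integral>\<omega>. R j \<omega> / N i \<omega> \<partial>M) \<le> (\<integral>\<omega>. Z j \<omega> / N i \<omega> \<partial>M)" if j: "j \<in> I0" for j
      unfolding N_def Z_def
    proof (rule null_rejection_proportion_bound[where \<tau> = \<tau> and lam = lam and a = a and P = P
          and j = j and S = S and C = C and R = R])
      show "indep_set (sets (pval_sigma M P {j})) (sets (pval_sigma M P (- {j})))"
        by (rule indep_nulls_imp_indep_rest[OF P_rv nulls rest j])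
      show "a j \<in> borel_measurable (pval_sigma M P {..<j})"
        by (rule a_past)
      show "lam j \<in> borel_measurable (pval_sigma M P {..<j})"
        "\<tau> j \<in> borel_measurable (pval_sigma M P {..<j})"
        by (rule pval_sigma_mono[OF lam_meas] pval_sigma_mono[OF \<tau>_meas], blast)+
      show "integrable M (\<lambda>\<omega>. a j \<omega> / (\<tau> j \<omega> - lam j \<omega>) * (S j \<omega> - C j \<omega>))"
        using Z_int[of j] unfolding Z_def .
      show "(\<lambda>\<omega>. real (max (card (rejections R i \<omega>)) 1)) \<in> borel_measurable M"
        using N_meas[of i] unfolding N_def .
    qed (use P_rv P_le null_valid[OF j] null_uniformly_valid[OF j] levels mono in blast |
        fact S_def C_def R_def)+
    have "FDR M I0 R i = (\<integral>\<omega>. (\<Sum>j\<in>I0 \<inter> {..i}. R j \<omega> / N i \<omega>) \<partial>M)"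
      unfolding FDR_def card_rej N_def sum_divide_distrib ..
    also have "\<dots> = (\<Sum>j\<in>I0 \<inter> {..i}. (\<integral>\<omega>. R j \<omega> / N i \<omega> \<partial>M))"
      using div_int[OF R_int] by (rule Bochner_Integration.integral_sum)
    also have "\<dots> \<le> (\<Sum>j\<in>I0 \<inter> {..i}. (\<integral>\<omega>. Z j \<omega> / N i \<omega> \<partial>M))"
      using null by (intro sum_mono) auto
    also have "\<dots> = (\<integral>\<omega>. (\<Sum>j\<in>I0 \<inter> {..i}. Z j \<omega> / N i \<omega>) \<partial>M)"
      using div_int[OF Z_int] by (rule Bochner_Integration.integral_sum[symmetric])
    \<comment> \<open>After division by \<open>N i\<close> the null part of the budget is at most
      \<open>\<alpha>\<close> for every outcome, hence also in expectation.\<close>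
    also have "\<dots> \<le> (\<integral>\<omega>. \<alpha> \<partial>M)"
    proof (rule integral_mono)
      fix \<omega> assume "\<omega> \<in> space M"
      with sum_null_Z[of \<omega> i] N_ge[of i \<omega>] show "(\<Sum>j\<in>I0 \<inter> {..i}. Z j \<omega> / N i \<omega>) \<le> \<alpha>"
        by (simp add: sum_divide_distrib[symmetric] divide_le_eq)
    qed (use div_int[OF Z_int] in auto)
    finally show ?thesis
      by (simp add: prob_space)
  qed

  show ?thesis
    using part_a part_b part_c unfolding N_def Z_def by blast
qed

end
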